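(* Let $n\ge1$, let $I_1,\ldots,I_n$ be independent random variables with values in $\{0,1\}$, $p_i=\Pr(I_i=1)=1-\Pr(I_i=0)\in[0,1]$, and let $S_n=I_1+\cdots+I_n$. Put $\lambda_j=\sum_{i=1}^n p_i^j$ for $j=1,2,\ldots$ and $\lambda=\lambda_1$, and assume $\lambda>0$. Let $\mu_m=\mathbb E\big[(S_n)_m\big]$ be the $m$-th factorial moment of $S_n$. Then $$\mu_m=m!\,S_{n,m},$$ where $S_{n,m}=\sum p_{i_1}\cdots p_{i_m}$, the sum running over all $\binom nm$ subsets $\{i_1,\ldots,i_m\}$ of size $m$ of $\{1,\ldots,n\}$ (with $S_{n,m}=0$ for $m>n$). Moreover, for all integers $m\ge1$, $$\lambda^m-\frac{(m)_2}{2}\lambda_2\lambda^{m-2}\;\le\;\mu_m\;\le\;\lambda^m-\frac{(m)_2}{2}\lambda_2\lambda^{m-2}+\frac{(m)_3}{3}\lambda_3\lambda^{m-3}+\frac{(m)_4}{8}\lambda_2^2\lambda^{m-4}=\mu_m(\phi_3).$$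
   Context: For integers $k,m\ge0$, $(k)_m=k(k-1)\cdots(k-m+1)$, with $(k)_0=1$; in particular $(m)_2=m(m-1)$, $(m)_3=m(m-1)(m-2)$, $(m)_4=m(m-1)(m-2)(m-3)$, and terms with a vanishing factor $(m)_j$ (i.e. $m<j$) are zero. The function $\phi_3$ (the third order corrected Poisson distribution, a possibly signed mass function) is $$\phi_3(k)=e^{-\lambda}\frac{\lambda^k}{k!}\Big(1-\frac{\lambda_2}{2\lambda^2}P_2(k)+\frac{\lambda_3}{3\lambda^3}P_3(k)+\frac{\lambda_2^2}{8\lambda^4}P_4(k)\Big),\quad k=0,1,\ldots,$$ with $P_m(k)=\sum_{j=0}^m(-1)^{m-j}\binom mj\lambda^{m-j}(k)_j$, and its factorial moments are $\mu_m(\phi_3)=\sum_{k=m}^\infty(k)_m\,\phi_3(k)$. *)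

theory Defs
  imports "HOL-Probability.Probability"
begin

text \<open>
  The falling factorial \<open>k (k - 1) \<dots> (k - m + 1)\<close>; the factors are real, so nothing is
  truncated, and the product vanishes for \<open>m > k\<close> because of the factor \<open>i = k\<close>.
\<close>

definition falling :: "nat \<Rightarrow> nat \<Rightarrow> real" where
  "falling k m = (\<Prod>i<m. real k - real i)"

definition elem_sym :: "nat \<Rightarrow> (nat \<Rightarrow> real) \<Rightarrow> nat \<Rightarrow> real" where
  "elem_sym n p m = (\<Sum>A\<in>{A. A \<subseteq> {1..n} \<and> card A = m}. \<Prod>i\<in>A. p i)"

text \<open>The parameter \<open>l\<close> of the polynomials \<open>P m\<close> is the Poisson mean \<open>\<lambda>\<close>.\<close>

definition charlier_poly :: "real \<Rightarrow> nat \<Rightarrow> nat \<Rightarrow> real" where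
  "charlier_poly l m k =
     (\<Sum>j=0..m. (- 1) ^ (m - j) * real (m choose j) * l ^ (m - j) * falling k j)"

text \<open>
  The third order corrected Poisson distribution, with \<open>l\<close>, \<open>l2\<close>, \<open>l3\<close> standing for
  \<open>\<lambda>\<close>, \<open>\<lambda>\<^sub>2\<close>, \<open>\<lambda>\<^sub>3\<close>. It may take negative values, so it is a plain function and not
  a \<open>pmf\<close>.
\<close>

definition phi3 :: "real \<Rightarrow> real \<Rightarrow> real \<Rightarrow> nat \<Rightarrow> real" where
  "phi3 l l2 l3 k =
     exp (- l) * (l ^ k / fact k) *
       (1 - l2 / (2 * l ^ 2) * charlier_poly l 2 k
          + l3 / (3 * l ^ 3) * charlier_poly l 3 k
          + l2 ^ 2 / (8 * l ^ 4) * charlier_poly l 4 k)"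

text \<open>
  The factorial moment \<open>\<Sum>\<^sub>k\<^sub>\<ge>\<^sub>m (k)\<^sub>m f(k)\<close> of a possibly signed mass function, the summation
  index being shifted by \<open>m\<close>. The value is meaningful only if the terms are summable.
\<close>

definition factorial_moment_term :: "(nat \<Rightarrow> real) \<Rightarrow> nat \<Rightarrow> nat \<Rightarrow> real" where
  "factorial_moment_term f m k = falling (k + m) m * f (k + m)"

definition factorial_moment :: "(nat \<Rightarrow> real) \<Rightarrow> nat \<Rightarrow> real" where
  "factorial_moment f m = (\<Sum>k. factorial_moment_term f m k)"

end

theory Submission
  imports Defs
begin

text \<open>
  The factorial moments of \<open>S = I\<^sub>1 + \<dots> + I\<^sub>n\<close> are, up to the factor \<open>m!\<close>, the coefficients of
  the probability generating function at \<open>1 + t\<close>, which by independence is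
  \<open>G(t) = \<Prod>\<^sub>i (1 + p\<^sub>i t)\<close>.  For the bounds, write
  \<open>G(t) = exp (\<lambda> t - \<lambda>\<^sub>2 t\<^sup>2 / 2 + \<lambda>\<^sub>3 t\<^sup>3 / 3 - \<dots>)\<close>.  The two bounds are, in the same scaling, the
  coefficients of the truncations
  \<open>L = exp (\<lambda> t) (1 - \<lambda>\<^sub>2 t\<^sup>2 / 2)\<close> and
  \<open>U = exp (\<lambda> t) (1 - \<lambda>\<^sub>2 t\<^sup>2 / 2 + \<lambda>\<^sub>3 t\<^sup>3 / 3 + \<lambda>\<^sub>2\<^sup>2 t\<^sup>4 / 8)\<close>,
  so that the claim is that \<open>L \<le> G \<le> U\<close> coefficient by coefficient.

  This order is preserved by multiplication with series that have nonnegative coefficients, so the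
  claim follows by adding one factor \<open>1 + c t\<close> at a time.  Adding it replaces
  \<open>\<lambda>, \<lambda>\<^sub>2, \<lambda>\<^sub>3\<close> by \<open>\<lambda> + c, \<lambda>\<^sub>2 + c\<^sup>2, \<lambda>\<^sub>3 + c\<^sup>3\<close>, and both \<open>(1 + c t) L\<close> minus the
  new \<open>L\<close> and the new \<open>U\<close> minus \<open>(1 + c t) U\<close> are \<open>exp (\<lambda> t)\<close> times a combination of the following
  three series (with \<open>u = c t\<close>), whose coefficients are polynomials in \<open>t\<close>, \<open>\<lambda>\<^sub>2\<close>, \<open>\<lambda>\<^sub>3\<close> with
  nonnegative constants:

  \<^item> \<open>R\<^sub>1 = exp u - (1 + u)\<close>,
  \<^item> \<open>R\<^sub>2 = (1 + u) - exp u (1 - u\<^sup>2 / 2)\<close>,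
  \<^item> \<open>R\<^sub>3 = exp u (1 - u\<^sup>2 / 2 + u\<^sup>3 / 3 + u\<^sup>4 / 8) - (1 + u)\<close>.

  Each of them has nonnegative coefficients, which is a statement about a single variable
  (\<open>exp_minus_affine_nonneg\<close>, \<open>affine_minus_corrected_exp_nonneg\<close>,
  \<open>corrected_exp_minus_affine_nonneg\<close>).  The decompositions are proved in
  \<open>lower_series_step\<close> and \<open>upper_series_step\<close>.

  The upper bound is the factorial moment of \<open>phi3\<close> because, for \<open>N\<close> Poisson with mean \<open>\<lambda>\<close>, weighting
  by \<open>(N)\<^sub>m\<close> amounts to multiplying by \<open>\<lambda>\<^sup>m\<close> and shifting \<open>N\<close> to \<open>N + m\<close>, and the Charlier
  polynomials satisfy \<open>E P\<^sub>j(N + m) = (m)\<^sub>j\<close> (\<open>charlier_poly_shift_sums\<close>).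
\<close>

section \<open>Falling factorials\<close>

lemma falling_0 [simp]: "falling k 0 = 1"
  by (simp add: falling_def)

lemma falling_Suc: "falling k (Suc m) = falling k m * (real k - real m)"
  by (simp add: falling_def)

lemma falling_eq_0_iff: "falling k m = 0 \<longleftrightarrow> k < m"
  by (auto simp: falling_def)

lemma falling_binomial: "falling k m = fact m * real (k choose m)"
proof -
  have "fact m * (real k gchoose m) = falling k m"
    by (simp add: gbinomial_mult_fact falling_def atLeast0LessThan)
  then show ?thesis
    by (simp add: binomial_gbinomial)
qed

lemma falling_nonneg: "0 \<le> falling k m"
  by (simp add: falling_binomial)

lemma falling_add_eq: "falling (k + m) m = fact (k + m) / fact k"
  by (simp add: falling_binomial binomial_fact)

lemma falling_Suc_left:
  "falling (Suc k) m = falling k m + real m * falling k (m - 1)"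
proof (cases m)
  case (Suc j)
  have "falling (Suc k) (Suc j) = (real k + 1) * falling k j"
    by (simp add: falling_def prod.lessThan_Suc_shift del: prod.lessThan_Suc)
  then show ?thesis
    by (simp add: Suc falling_Suc algebra_simps)
qed simp

section \<open>Coefficientwise nonnegative power series\<close>

text \<open>
  The coefficientwise inequality \<open>F \<le> G\<close> is written \<open>nonneg_coeffs (G - F)\<close>, so that an
  algebraic decomposition of the difference proves it directly.
\<close>

definition nonneg_coeffs :: "real fps \<Rightarrow> bool" where
  "nonneg_coeffs F \<longleftrightarrow> (\<forall>k. 0 \<le> fps_nth F k)"

lemma nonneg_coeffs_add:
  "nonneg_coeffs F \<Longrightarrow> nonneg_coeffs G \<Longrightarrow> nonneg_coeffs (F + G)"
  by (simp add: nonneg_coeffs_def)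

lemma nonneg_coeffs_mult:
  "nonneg_coeffs F \<Longrightarrow> nonneg_coeffs G \<Longrightarrow> nonneg_coeffs (F * G)"
  by (auto simp: nonneg_coeffs_def fps_mult_nth intro!: sum_nonneg)

lemma nonneg_coeffs_const_X_power: "0 \<le> c \<Longrightarrow> nonneg_coeffs (fps_const c * fps_X ^ j)"
  by (simp add: nonneg_coeffs_def)

lemma nonneg_coeffs_exp: "0 \<le> c \<Longrightarrow> nonneg_coeffs (fps_exp c)"
  by (simp add: nonneg_coeffs_def)

text \<open>
  Pulling \<open>c\<^sup>k / k!\<close> out of every coefficient of \<open>(c t)\<^sup>j exp (c t)\<close> reduces inequalities for
  combinations of such series to inequalities between polynomials in \<open>k\<close>.
\<close>

lemma exp_shift_nth:
  "fps_nth (fps_const (c ^ j) * fps_X ^ j * fps_exp c) k = c ^ k / fact k * falling k j"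
proof (cases "k < j")
  case True
  then show ?thesis
    using falling_eq_0_iff[of k j]
    by (simp add: mult.assoc fps_X_power_mult_nth)
next
  case False
  then obtain i where k: "k = i + j"
    by (metis add.commute le_Suc_ex not_less)
  show ?thesis
    by (simp add: k falling_add_eq mult.assoc fps_X_power_mult_nth power_add)
qed

text \<open>
  The link between series and the explicit bounds: the vanishing falling factorial takes care of
  the negative exponents.
\<close>

lemma fps_X_power_exp_nth:
  "fps_nth (fps_X ^ j * fps_exp c) k * fact k = falling k j * c powi (int k - int j)"
proof (cases "k < j")
  case True
  then show ?thesis
    using falling_eq_0_iff[of k j] by (simp add: fps_X_power_mult_nth)
next
  case False
  then obtain i where k: "k = i + j"
    by (metis add.commute le_Suc_ex not_less)
  show ?thesis
    by (simp add: k falling_add_eq fps_X_power_mult_nth)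
qed

abbreviation linear_factor :: "real \<Rightarrow> real fps" where
  "linear_factor c \<equiv> 1 + fps_const c * fps_X"

lemma linear_factor_nth: "fps_nth (linear_factor c) k = (if k = 0 then 1 else if k = 1 then c else 0)"
  by (cases k) auto

lemma nonneg_coeffs_linear_factor: "0 \<le> c \<Longrightarrow> nonneg_coeffs (linear_factor c)"
  unfolding nonneg_coeffs_def linear_factor_nth by simp

lemma exp_minus_affine_nonneg:
  assumes "0 \<le> c" shows "nonneg_coeffs (fps_exp c - linear_factor c)"
  unfolding nonneg_coeffs_def
proof
  show "0 \<le> fps_nth (fps_exp c - linear_factor c) k" for k
    using assms by (cases "k = 0"; cases "k = 1") (simp_all add: linear_factor_nth)
qed

text \<open>
  For \<open>k \<ge> 2\<close> the coefficient is \<open>c\<^sup>k / k!\<close> times \<open>k (k - 1) / 2 - 1 \<ge> 0\<close>, and the coefficients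
  of order 0 and 1 cancel.
\<close>

lemma affine_minus_corrected_exp_nonneg:
  assumes "0 \<le> c"
  shows "nonneg_coeffs (linear_factor c - (1 - fps_const (c ^ 2 / 2) * fps_X ^ 2) * fps_exp c)"
  unfolding nonneg_coeffs_def
proof
  fix k
  have "linear_factor c - (1 - fps_const (c ^ 2 / 2) * fps_X ^ 2) * fps_exp c =
      linear_factor c - fps_exp c + fps_const (1 / 2) * (fps_const (c ^ 2) * fps_X ^ 2 * fps_exp c)"
    by (simp add: algebra_simps flip: fps_const_mult)
  then have "fps_nth (linear_factor c - (1 - fps_const (c ^ 2 / 2) * fps_X ^ 2) * fps_exp c) k =
      fps_nth (linear_factor c) k - c ^ k / fact k + c ^ k / fact k * falling k 2 / 2"
    by (simp only: fps_add_nth fps_sub_nth fps_mult_left_const_nth exp_shift_nth) simp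
  also have "\<dots> = fps_nth (linear_factor c) k + c ^ k / fact k * (falling k 2 / 2 - 1)"
    by (simp add: algebra_simps)
  also have "0 \<le> \<dots>"
  proof (cases "k < 2")
    case True
    then consider "k = 0" | "k = 1"
      by linarith
    then show ?thesis
      by cases (simp_all add: linear_factor_nth falling_Suc numeral_2_eq_2)
  next
    case False
    then obtain i where "k = i + 2"
      by (metis add.commute le_Suc_ex not_less)
    then have "1 \<le> falling k 2 / 2"
      by (simp add: falling_Suc numeral_2_eq_2 algebra_simps)
    then show ?thesis
      using assms False by (simp add: linear_factor_nth)
  qed
  finally show "0 \<le> fps_nth (linear_factor c - (1 - fps_const (c ^ 2 / 2) * fps_X ^ 2) * fps_exp c) k" .
qed

text \<open>
  Here the coefficient for \<open>k \<ge> 2\<close> is \<open>c\<^sup>k / k!\<close> times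
  \<open>1 - (k)\<^sub>2 / 2 + (k)\<^sub>3 / 3 + (k)\<^sub>4 / 8\<close>, which vanishes at \<open>k = 2\<close> and \<open>k = 3\<close>.
  For \<open>k = i + 3\<close> its first three terms form a polynomial in \<open>i\<close> with nonnegative coefficients.
\<close>

lemma corrected_exp_minus_affine_nonneg:
  assumes "0 \<le> c"
  shows "nonneg_coeffs ((1 - fps_const (c ^ 2 / 2) * fps_X ^ 2 + fps_const (c ^ 3 / 3) * fps_X ^ 3
    + fps_const (c ^ 4 / 8) * fps_X ^ 4) * fps_exp c - linear_factor c)"
    (is "nonneg_coeffs ?D")
  unfolding nonneg_coeffs_def
proof
  fix k
  \<comment> \<open>Isolates the powers of \<open>c\<close> so that \<open>exp_shift_nth\<close> applies to each summand.\<close>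
  have scale: "fps_const (x / a) = fps_const (1 / a) * fps_const x" for x a :: real
    by simp
  have "?D = fps_exp c - linear_factor c
      - fps_const (1 / 2) * (fps_const (c ^ 2) * fps_X ^ 2 * fps_exp c)
      + fps_const (1 / 3) * (fps_const (c ^ 3) * fps_X ^ 3 * fps_exp c)
      + fps_const (1 / 8) * (fps_const (c ^ 4) * fps_X ^ 4 * fps_exp c)"
    unfolding scale[of "c ^ 2" 2] scale[of "c ^ 3" 3] scale[of "c ^ 4" 8]
    by (simp add: algebra_simps del: fps_const_mult)
  then have "fps_nth ?D k =
      c ^ k / fact k - fps_nth (linear_factor c) k - c ^ k / fact k * falling k 2 / 2
      + c ^ k / fact k * falling k 3 / 3 + c ^ k / fact k * falling k 4 / 8"
    by (simp only: fps_add_nth fps_sub_nth fps_mult_left_const_nth exp_shift_nth) simp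
  also have "\<dots> = c ^ k / fact k * (1 - falling k 2 / 2 + falling k 3 / 3 + falling k 4 / 8)
      - fps_nth (linear_factor c) k"
    by (simp add: algebra_simps)
  also have "0 \<le> \<dots>"
  proof (cases "k < 2")
    case True
    then consider "k = 0" | "k = 1"
      by linarith
    then show ?thesis
      by cases (simp_all add: linear_factor_nth falling_Suc numeral_eq_Suc)
  next
    case False
    have "0 \<le> 1 - falling k 2 / 2 + falling k 3 / 3 + falling k 4 / 8"
    proof (cases "k = 2")
      case True
      then show ?thesis
        by (simp add: falling_Suc numeral_eq_Suc)
    next
      case False
      with \<open>\<not> k < 2\<close> obtain i where k: "k = i + 3"
        by (metis add.commute le_Suc_ex linorder_neqE_nat not_less_eq numeral_3_eq_3 numeral_2_eq_2 leI)
      have "1 - falling k 2 / 2 + falling k 3 / 3 =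
          ((real i + 3) * (real i + 2) * (2 * real i - 1) + 6) / 6"
        by (simp add: numeral_3_eq_3 numeral_2_eq_2 falling_Suc k field_simps)
      also have "\<dots> = (2 * real i ^ 3 + 9 * real i ^ 2 + 7 * real i) / 6"
        by (simp add: algebra_simps power2_eq_square power3_eq_cube)
      also have "0 \<le> \<dots>"
        by simp
      finally show ?thesis
        using falling_nonneg[of k 4] by linarith
    qed
    then show ?thesis
      using assms False by (simp add: linear_factor_nth)
  qed
  finally show "0 \<le> fps_nth ?D k" .
qed

section \<open>Coefficientwise bounds for the generating function\<close>

definition lower_series :: "real \<Rightarrow> real \<Rightarrow> real fps" where
  "lower_series l l2 = (1 - fps_const (l2 / 2) * fps_X ^ 2) * fps_exp l"

definition upper_series :: "real \<Rightarrow> real \<Rightarrow> real \<Rightarrow> real fps" where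
  "upper_series l l2 l3 = (1 - fps_const (l2 / 2) * fps_X ^ 2 + fps_const (l3 / 3) * fps_X ^ 3
     + fps_const (l2 ^ 2 / 8) * fps_X ^ 4) * fps_exp l"

text \<open>
  In the notation of the introduction the difference is
  \<open>exp (l t) (R\<^sub>2 + l2 t\<^sup>2 / 2 \<cdot> R\<^sub>1)\<close>.
\<close>

lemma lower_series_step:
  assumes "0 \<le> l" "0 \<le> l2" "0 \<le> c"
  shows "nonneg_coeffs (linear_factor c * lower_series l l2 - lower_series (l + c) (l2 + c ^ 2))"
proof -
  define e where "e = fps_exp c"
  have half: "fps_const ((l2 + c ^ 2) / 2) = fps_const (l2 / 2) + fps_const (c ^ 2 / 2)"
    by (simp add: add_divide_distrib)
  have "linear_factor c * lower_series l l2 - lower_series (l + c) (l2 + c ^ 2) =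
      fps_exp l * ((linear_factor c - (1 - fps_const (c ^ 2 / 2) * fps_X ^ 2) * e)
        + fps_const (l2 / 2) * fps_X ^ 2 * (e - linear_factor c))"
    unfolding lower_series_def fps_exp_add_mult half e_def
    by (simp add: algebra_simps del: fps_const_add fps_const_mult)
  then show ?thesis
    unfolding e_def using assms
    by (simp only:) (intro nonneg_coeffs_mult nonneg_coeffs_add nonneg_coeffs_exp
      nonneg_coeffs_const_X_power affine_minus_corrected_exp_nonneg exp_minus_affine_nonneg; simp)
qed

text \<open>
  The difference is \<open>exp (l t) (R\<^sub>3 + l2 t\<^sup>2 / 2 \<cdot> R\<^sub>2 + (l3 t\<^sup>3 / 3 + l2\<^sup>2 t\<^sup>4 / 8) R\<^sub>1)\<close>.
  The term \<open>R\<^sub>2\<close> appears because the cross term \<open>l2 c\<^sup>2 t\<^sup>4 / 4\<close> in \<open>(l2 + c\<^sup>2)\<^sup>2 t\<^sup>4 / 8\<close>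
  is \<open>l2 t\<^sup>2 / 2\<close> times \<open>u\<^sup>2 / 2\<close>: the square in the last correction is what compensates the
  negative second-order term.
\<close>

lemma upper_series_step:
  assumes "0 \<le> l" "0 \<le> l2" "0 \<le> l3" "0 \<le> c"
  shows "nonneg_coeffs (upper_series (l + c) (l2 + c ^ 2) (l3 + c ^ 3)
    - linear_factor c * upper_series l l2 l3)"
proof -
  define e where "e = fps_exp c"
  have scalars: "fps_const ((l2 + c ^ 2) / 2) = fps_const (l2 / 2) + fps_const (c ^ 2 / 2)"
    "fps_const ((l3 + c ^ 3) / 3) = fps_const (l3 / 3) + fps_const (c ^ 3 / 3)"
    "fps_const ((l2 + c ^ 2) ^ 2 / 8) =
      fps_const (l2 ^ 2 / 8) + fps_const (l2 / 2) * fps_const (c ^ 2 / 2) + fps_const (c ^ 4 / 8)"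
    by (simp_all add: field_simps power2_eq_square power4_eq_xxxx)
  have "upper_series (l + c) (l2 + c ^ 2) (l3 + c ^ 3) - linear_factor c * upper_series l l2 l3 =
      fps_exp l * (((1 - fps_const (c ^ 2 / 2) * fps_X ^ 2 + fps_const (c ^ 3 / 3) * fps_X ^ 3
          + fps_const (c ^ 4 / 8) * fps_X ^ 4) * e - linear_factor c)
        + fps_const (l2 / 2) * fps_X ^ 2 * (linear_factor c - (1 - fps_const (c ^ 2 / 2) * fps_X ^ 2) * e)
        + fps_const (l3 / 3) * fps_X ^ 3 * (e - linear_factor c)
        + fps_const (l2 ^ 2 / 8) * fps_X ^ 4 * (e - linear_factor c))"
    unfolding upper_series_def fps_exp_add_mult scalars e_def
    by (simp add: algebra_simps power_numeral_reduce del: fps_const_add fps_const_mult)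
  then show ?thesis
    unfolding e_def using assms
    by (simp only:) (intro nonneg_coeffs_mult nonneg_coeffs_add nonneg_coeffs_exp
      nonneg_coeffs_const_X_power affine_minus_corrected_exp_nonneg exp_minus_affine_nonneg
      corrected_exp_minus_affine_nonneg; simp)
qed

text \<open>
  With \<open>P\<close> the product over the old factors, the difference for one more factor \<open>f\<close> is
  \<open>f (P - L) + (f L - L')\<close>, where \<open>L\<close> and \<open>L'\<close> are the old and the new truncation.  The upper bound
  is treated in the same way.
\<close>

lemma lower_series_le_prod:
  assumes "finite A" "\<And>i. i \<in> A \<Longrightarrow> 0 \<le> p i"
  shows "nonneg_coeffs ((\<Prod>i\<in>A. linear_factor (p i))
    - lower_series (\<Sum>i\<in>A. p i) (\<Sum>i\<in>A. p i ^ 2))"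
  using assms
proof (induction A rule: finite_induct)
  case empty
  show ?case by (simp add: lower_series_def nonneg_coeffs_def)
next
  case (insert a A)
  let ?P = "\<Prod>i\<in>A. linear_factor (p i)"
    and ?l = "\<Sum>i\<in>A. p i" and ?l2 = "\<Sum>i\<in>A. p i ^ 2"
  have nonneg: "0 \<le> p a" "0 \<le> ?l" "0 \<le> ?l2"
    using insert.prems by (auto intro: sum_nonneg)
  have "nonneg_coeffs (linear_factor (p a) * (?P - lower_series ?l ?l2)
      + (linear_factor (p a) * lower_series ?l ?l2 - lower_series (?l + p a) (?l2 + p a ^ 2)))"
    using nonneg insert.prems
    by (intro nonneg_coeffs_add nonneg_coeffs_mult nonneg_coeffs_linear_factor lower_series_step
      insert.IH) auto
  then show ?case
    using insert.hyps by (simp add: right_diff_distrib add.commute)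
qed

lemma prod_le_upper_series:
  assumes "finite A" "\<And>i. i \<in> A \<Longrightarrow> 0 \<le> p i"
  shows "nonneg_coeffs (upper_series (\<Sum>i\<in>A. p i) (\<Sum>i\<in>A. p i ^ 2) (\<Sum>i\<in>A. p i ^ 3)
    - (\<Prod>i\<in>A. linear_factor (p i)))"
  using assms
proof (induction A rule: finite_induct)
  case empty
  show ?case by (simp add: upper_series_def nonneg_coeffs_def)
next
  case (insert a A)
  let ?P = "\<Prod>i\<in>A. linear_factor (p i)"
    and ?l = "\<Sum>i\<in>A. p i" and ?l2 = "\<Sum>i\<in>A. p i ^ 2" and ?l3 = "\<Sum>i\<in>A. p i ^ 3"
  have nonneg: "0 \<le> p a" "0 \<le> ?l" "0 \<le> ?l2" "0 \<le> ?l3"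
    using insert.prems by (auto intro: sum_nonneg)
  have "nonneg_coeffs (linear_factor (p a) * (upper_series ?l ?l2 ?l3 - ?P)
      + (upper_series (?l + p a) (?l2 + p a ^ 2) (?l3 + p a ^ 3)
        - linear_factor (p a) * upper_series ?l ?l2 ?l3))"
    using nonneg insert.prems
    by (intro nonneg_coeffs_add nonneg_coeffs_mult nonneg_coeffs_linear_factor upper_series_step
      insert.IH) auto
  then show ?case
    using insert.hyps by (simp add: right_diff_distrib add.commute)
qed

lemma lower_series_nth:
  "fact m * fps_nth (lower_series l l2) m = l ^ m - falling m 2 / 2 * l2 * l powi (int m - 2)"
proof -
  have "fact m * fps_nth (lower_series l l2) m =
      fps_nth (fps_X ^ 0 * fps_exp l) m * fact m
      - l2 / 2 * (fps_nth (fps_X ^ 2 * fps_exp l) m * fact m)"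
    unfolding lower_series_def
    by (simp only: ring_distribs mult.assoc fps_sub_nth fps_mult_left_const_nth) (simp add: algebra_simps)
  then show ?thesis
    by (simp only: fps_X_power_exp_nth) (simp add: mult_ac)
qed

lemma upper_series_nth:
  "fact m * fps_nth (upper_series l l2 l3) m =
    l ^ m - falling m 2 / 2 * l2 * l powi (int m - 2)
      + falling m 3 / 3 * l3 * l powi (int m - 3) + falling m 4 / 8 * l2\<^sup>2 * l powi (int m - 4)"
proof -
  have "fact m * fps_nth (upper_series l l2 l3) m =
      fps_nth (fps_X ^ 0 * fps_exp l) m * fact m
      - l2 / 2 * (fps_nth (fps_X ^ 2 * fps_exp l) m * fact m)
      + l3 / 3 * (fps_nth (fps_X ^ 3 * fps_exp l) m * fact m)
      + l2 ^ 2 / 8 * (fps_nth (fps_X ^ 4 * fps_exp l) m * fact m)"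
    unfolding upper_series_def
    by (simp only: ring_distribs mult.assoc fps_sub_nth fps_add_nth fps_mult_left_const_nth)
      (simp add: algebra_simps)
  then show ?thesis
    by (simp only: fps_X_power_exp_nth) (simp add: mult_ac)
qed

section \<open>Factorial moments of sums of independent indicators\<close>

lemma prod_linear_factor_nth:
  "fps_nth (\<Prod>i=1..n. linear_factor (p i)) m = elem_sym n p m"
proof -
  have "(\<Prod>i=1..n. linear_factor (p i)) = (\<Prod>i=1..n. fps_const (p i) * fps_X + 1)"
    by (simp add: add.commute)
  also have "\<dots> = (\<Sum>A\<in>Pow {1..n}. fps_const (\<Prod>i\<in>A. p i) * fps_X ^ card A)"
  proof -
    have "(\<Prod>i\<in>A. fps_const (p i)) = fps_const (\<Prod>i\<in>A. p i)" for A
      by (induction A rule: infinite_finite_induct) simp_all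
    then show ?thesis
      by (subst prod_add) (simp_all add: prod.distrib)
  qed
  also have "fps_nth \<dots> m = (\<Sum>A\<in>Pow {1..n}. if card A = m then \<Prod>i\<in>A. p i else 0)"
    unfolding fps_sum_nth by (auto intro!: sum.cong)
  also have "\<dots> = elem_sym n p m"
    unfolding elem_sym_def Pow_iff[symmetric] by (rule sum.inter_filter[symmetric]) simp
  finally show ?thesis .
qed

text \<open>
  For a 0/1 vector \<open>1 + x\<^sub>i t = (1 + t) ^ x\<^sub>i\<close>, so the generating function of the elementary
  symmetric polynomials is \<open>(1 + t) ^ s\<close>, where \<open>s\<close> is the sum of the entries, with binomial
  coefficients.
\<close>

lemma elem_sym_zero_one:
  assumes "\<And>i. i \<in> {1..n} \<Longrightarrow> x i \<in> {0, 1}"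
  shows "fact m * elem_sym n (\<lambda>i. real (x i)) m = falling (\<Sum>i=1..n. x i) m"
proof -
  have "linear_factor (real (x i)) = (1 + fps_X) ^ x i" if "i \<in> {1..n}" for i
    using assms[OF that] by auto
  then have "(\<Prod>i=1..n. linear_factor (real (x i))) = (1 + fps_X) ^ (\<Sum>i=1..n. x i)"
    unfolding power_sum by (intro prod.cong refl)
  then have "elem_sym n (\<lambda>i. real (x i)) m = fps_nth ((1 + fps_X) ^ (\<Sum>i=1..n. x i)) m"
    by (simp only: flip: prod_linear_factor_nth)
  also have "\<dots> = real ((\<Sum>i=1..n. x i) choose m)"
    by (simp only: binomial_gbinomial fps_binomial_nth flip: fps_binomial_of_nat)
  finally show ?thesis
    by (simp add: falling_binomial)
qed

text \<open>
  By \<open>elem_sym_zero_one\<close> the falling factorial of the sum is pointwise \<open>m!\<close> times a sum of products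
  of distinct indicators, and independence turns the expectation of each product into the product
  of the probabilities.
\<close>

lemma factorial_moment_eq_elem_sym:
  assumes "prob_space M"
    and indep: "prob_space.indep_vars M (\<lambda>_. count_space UNIV) X {1..n}"
    and zero_one: "\<And>i \<omega>. i \<in> {1..n} \<Longrightarrow> \<omega> \<in> space M \<Longrightarrow> X i \<omega> \<in> {0, 1 :: nat}"
    and p: "\<And>i. i \<in> {1..n} \<Longrightarrow> p i = measure M {\<omega> \<in> space M. X i \<omega> = 1}"
  shows "(\<integral>\<omega>. falling (\<Sum>i=1..n. X i \<omega>) m \<partial>M) = fact m * elem_sym n p m"
proof -
  interpret prob_space M by fact
  let ?Y = "\<lambda>i \<omega>. real (X i \<omega>)"
  have indep_Y: "indep_vars (\<lambda>_. borel) ?Y A" if "A \<subseteq> {1..n}" for A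
    using indep_vars_compose2[OF indep_vars_subset[OF indep that], of "\<lambda>_. real" "\<lambda>_. borel"]
    by simp
  have X [measurable]: "X i \<in> measurable M (count_space UNIV)" if "i \<in> {1..n}" for i
    using indep that by (simp add: indep_vars_def)
  have Y_indicator: "?Y i \<omega> = indicator {\<omega> \<in> space M. X i \<omega> = 1} \<omega>"
    if "i \<in> {1..n}" "\<omega> \<in> space M" for i \<omega>
    using zero_one[OF that] that by (auto simp: indicator_def)
  have event: "{\<omega> \<in> space M. X i \<omega> = 1} \<in> events" if "i \<in> {1..n}" for i
    using X[OF that] by measurable
  have Y_integrable: "integrable M (?Y i)" if "i \<in> {1..n}" for i
    using event[OF that]
    by (subst Bochner_Integration.integrable_cong[OF refl Y_indicator[OF that]])
      (simp_all add: less_top[symmetric])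
  have Y_expectation: "expectation (?Y i) = p i" if "i \<in> {1..n}" for i
    using event[OF that]
    by (subst Bochner_Integration.integral_cong[OF refl Y_indicator[OF that]])
      (simp_all add: p[OF that] Int_absorb2 sets.sets_into_space)
  have prods: "integrable M (\<lambda>\<omega>. \<Prod>i\<in>A. ?Y i \<omega>)"
    "expectation (\<lambda>\<omega>. \<Prod>i\<in>A. ?Y i \<omega>) = (\<Prod>i\<in>A. p i)" if "A \<subseteq> {1..n}" for A
  proof -
    have "finite A"
      using that finite_subset by blast
    note independent = this indep_Y[OF that] Y_integrable[OF subsetD[OF that]]
    show "integrable M (\<lambda>\<omega>. \<Prod>i\<in>A. ?Y i \<omega>)"
      by (rule indep_vars_integrable[OF independent])
    show "expectation (\<lambda>\<omega>. \<Prod>i\<in>A. ?Y i \<omega>) = (\<Prod>i\<in>A. p i)"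
      using Y_expectation that
      by (subst indep_vars_lebesgue_integral[OF independent]) (auto intro!: prod.cong)
  qed
  have "(\<integral>\<omega>. falling (\<Sum>i=1..n. X i \<omega>) m \<partial>M) =
      (\<integral>\<omega>. fact m * elem_sym n (\<lambda>i. ?Y i \<omega>) m \<partial>M)"
    by (intro Bochner_Integration.integral_cong refl elem_sym_zero_one[symmetric] zero_one)
  also have "\<dots> = fact m * elem_sym n p m"
    unfolding elem_sym_def using prods
    by (simp add: Bochner_Integration.integral_sum)
  finally show ?thesis .
qed

section \<open>Charlier polynomials under the Poisson distribution\<close>

text \<open>
  The Charlier polynomials satisfy the same difference equation as the falling factorials
  (\<open>falling_Suc_left\<close>), by the absorption identity \<open>(i + 1) (j choose (i + 1)) = j ((j - 1) choose i)\<close>.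
  For \<open>j = 0\<close> the truncated index \<open>j - 1\<close> is harmless, since its factor vanishes.
\<close>

lemma charlier_poly_Suc_arg:
  "charlier_poly l j (Suc k) = charlier_poly l j k + real j * charlier_poly l (j - 1) k"
proof (cases j)
  case 0
  then show ?thesis by (simp add: charlier_poly_def)
next
  case (Suc r)
  let ?c = "\<lambda>i. (- 1) ^ (j - i) * real (j choose i) * l ^ (j - i)"
  have "charlier_poly l j (Suc k) =
      (\<Sum>i=0..j. ?c i * falling k i) + (\<Sum>i=0..j. ?c i * (real i * falling k (i - 1)))"
    by (simp add: charlier_poly_def falling_Suc_left ring_distribs sum.distrib)
  also have "(\<Sum>i=0..j. ?c i * (real i * falling k (i - 1))) =
      (\<Sum>i=0..j - 1. ?c (Suc i) * (real (Suc i) * falling k i))"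
    unfolding Suc sum.atLeast0_atMost_Suc_shift by simp
  also have "\<dots> = real j * charlier_poly l (j - 1) k"
  proof -
    have "real (Suc i) * real (j choose Suc i) = real j * real (r choose i)" for i
      unfolding Suc by (simp only: Suc_times_binomial flip: of_nat_mult)
    then have "?c (Suc i) * (real (Suc i) * falling k i) =
        real j * ((- 1) ^ (j - 1 - i) * real ((j - 1) choose i) * l ^ (j - 1 - i) * falling k i)" for i
      by (simp add: Suc del: of_nat_Suc binomial_Suc_Suc) (simp add: algebra_simps)
    then show ?thesis
      by (simp only: charlier_poly_def sum_distrib_left)
  qed
  finally show ?thesis
    by (simp add: charlier_poly_def)
qed

text \<open>The factorial moments \<open>l\<^sup>i\<close> of the Poisson distribution, without its normalization.\<close>

lemma falling_exp_sums: "(\<lambda>k. l ^ k / fact k * falling k i) sums (exp l * l ^ i)"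
proof -
  have "(\<lambda>k. l ^ i * (l ^ k / fact k)) sums (l ^ i * exp l)"
    using exp_converges[of l] by (intro sums_mult) (simp add: divide_inverse mult.commute)
  then have "(\<lambda>k. l ^ (k + i) / fact (k + i) * falling (k + i) i) sums (exp l * l ^ i)"
    by (simp add: falling_add_eq power_add mult.commute)
  then show ?thesis
    by (subst (asm) sums_zero_iff_shift) (simp_all add: falling_eq_0_iff)
qed

text \<open>
  As functions of \<open>m\<close> and \<open>j\<close>, both sides satisfy the same recursion in \<open>m\<close>, so it suffices to
  compare them at \<open>m = 0\<close>, where the sum is \<open>exp l \<cdot> (l - l) ^ j\<close> by the binomial theorem.
\<close>

lemma charlier_poly_shift_sums:
  "(\<lambda>k. l ^ k / fact k * charlier_poly l j (k + m)) sums (exp l * falling m j)"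
proof (induction m arbitrary: j)
  case 0
  have "(\<lambda>k. \<Sum>i=0..j. (- 1) ^ (j - i) * real (j choose i) * l ^ (j - i) *
        (l ^ k / fact k * falling k i))
      sums (\<Sum>i=0..j. (- 1) ^ (j - i) * real (j choose i) * l ^ (j - i) * (exp l * l ^ i))"
    by (intro sums_sum sums_mult falling_exp_sums)
  also have "(\<Sum>i=0..j. (- 1) ^ (j - i) * real (j choose i) * l ^ (j - i) * (exp l * l ^ i)) =
      exp l * (l + - l) ^ j"
    unfolding binomial_ring atMost_atLeast0 sum_distrib_left
    by (intro sum.cong refl) (simp add: power_minus[of l] algebra_simps)
  also have "exp l * (l + - l) ^ j = exp l * falling 0 j"
    by (cases j) (simp_all add: falling_eq_0_iff)
  finally show ?case
    by (simp add: charlier_poly_def sum_distrib_left algebra_simps)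
next
  case (Suc m)
  have "(\<lambda>k. l ^ k / fact k * charlier_poly l j (k + m)
        + real j * (l ^ k / fact k * charlier_poly l (j - 1) (k + m)))
      sums (exp l * falling m j + real j * (exp l * falling m (j - 1)))"
    by (intro sums_add sums_mult Suc)
  then show ?case
    by (simp add: charlier_poly_Suc_arg falling_Suc_left algebra_simps)
qed

text \<open>
  The factor \<open>(k + m)\<^sub>m\<close> turns the weight \<open>l\<^sup>k\<^sup>+\<^sup>m / (k + m)!\<close> into \<open>l\<^sup>m \<cdot> l\<^sup>k / k!\<close>, after which
  the terms of \<open>phi3\<close> are shifted Charlier polynomials of degree 0, 2, 3 and 4.
\<close>

lemma phi3_factorial_moment_sums:
  "factorial_moment_term (phi3 l l2 l3) m sums
    (l ^ m * (1 - l2 / (2 * l ^ 2) * falling m 2 + l3 / (3 * l ^ 3) * falling m 3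
      + l2 ^ 2 / (8 * l ^ 4) * falling m 4))"
proof -
  let ?w = "\<lambda>k. l ^ k / fact k" and ?C = "\<lambda>j k. charlier_poly l j (k + m)"
  have "(\<lambda>k. exp (- l) * l ^ m * (?w k * ?C 0 k - l2 / (2 * l ^ 2) * (?w k * ?C 2 k)
        + l3 / (3 * l ^ 3) * (?w k * ?C 3 k) + l2 ^ 2 / (8 * l ^ 4) * (?w k * ?C 4 k)))
      sums (exp (- l) * l ^ m * (exp l * falling m 0 - l2 / (2 * l ^ 2) * (exp l * falling m 2)
        + l3 / (3 * l ^ 3) * (exp l * falling m 3) + l2 ^ 2 / (8 * l ^ 4) * (exp l * falling m 4)))"
    by (intro sums_mult sums_add sums_diff charlier_poly_shift_sums)
  moreover have "factorial_moment_term (phi3 l l2 l3) m =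
      (\<lambda>k. exp (- l) * l ^ m * (?w k * ?C 0 k - l2 / (2 * l ^ 2) * (?w k * ?C 2 k)
        + l3 / (3 * l ^ 3) * (?w k * ?C 3 k) + l2 ^ 2 / (8 * l ^ 4) * (?w k * ?C 4 k)))"
  proof
    fix k
    have weight: "falling (k + m) m * (l ^ (k + m) / fact (k + m)) = l ^ m * ?w k"
      by (simp add: falling_add_eq power_add)
    have "factorial_moment_term (phi3 l l2 l3) m k =
        exp (- l) * (falling (k + m) m * (l ^ (k + m) / fact (k + m))) *
          (1 - l2 / (2 * l ^ 2) * ?C 2 k + l3 / (3 * l ^ 3) * ?C 3 k + l2 ^ 2 / (8 * l ^ 4) * ?C 4 k)"
      by (simp add: factorial_moment_term_def phi3_def)
    also have "\<dots> = exp (- l) * (l ^ m * ?w k) *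
          (1 - l2 / (2 * l ^ 2) * ?C 2 k + l3 / (3 * l ^ 3) * ?C 3 k + l2 ^ 2 / (8 * l ^ 4) * ?C 4 k)"
      by (simp only: weight)
    finally show "factorial_moment_term (phi3 l l2 l3) m k =
        exp (- l) * l ^ m * (?w k * ?C 0 k - l2 / (2 * l ^ 2) * (?w k * ?C 2 k)
          + l3 / (3 * l ^ 3) * (?w k * ?C 3 k) + l2 ^ 2 / (8 * l ^ 4) * (?w k * ?C 4 k))"
      by (simp add: charlier_poly_def[of l 0] algebra_simps)
  qed
  moreover have "exp (- l) * l ^ m * (exp l * falling m 0 - l2 / (2 * l ^ 2) * (exp l * falling m 2)
        + l3 / (3 * l ^ 3) * (exp l * falling m 3) + l2 ^ 2 / (8 * l ^ 4) * (exp l * falling m 4)) =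
      l ^ m * (1 - l2 / (2 * l ^ 2) * falling m 2 + l3 / (3 * l ^ 3) * falling m 3
      + l2 ^ 2 / (8 * l ^ 4) * falling m 4)"
  proof -
    have "exp (- l) * l ^ m * (exp l * falling m 0 - l2 / (2 * l ^ 2) * (exp l * falling m 2)
        + l3 / (3 * l ^ 3) * (exp l * falling m 3) + l2 ^ 2 / (8 * l ^ 4) * (exp l * falling m 4)) =
      (exp (- l) * exp l) * (l ^ m * (1 - l2 / (2 * l ^ 2) * falling m 2
        + l3 / (3 * l ^ 3) * falling m 3 + l2 ^ 2 / (8 * l ^ 4) * falling m 4))"
      by (simp add: algebra_simps)
    then show ?thesis
      by (simp flip: exp_add)
  qed
  ultimately show ?thesis
    by (simp only:)
qed

section \<open>The bounds for the factorial moments\<close>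

theorem lemma4p2:
  fixes M :: "'a measure" and n :: nat and X :: "nat \<Rightarrow> 'a \<Rightarrow> nat"
    and p lam mu :: "nat \<Rightarrow> real"
  assumes "prob_space M"
    and "n \<ge> 1"
    and "prob_space.indep_vars M (\<lambda>_. count_space UNIV) X {1..n}"
    and "\<And>i \<omega>. i \<in> {1..n} \<Longrightarrow> \<omega> \<in> space M \<Longrightarrow> X i \<omega> \<in> {0, 1}"
    and "\<And>i. i \<in> {1..n} \<Longrightarrow> p i = measure M {\<omega> \<in> space M. X i \<omega> = 1}"
    and "\<And>j. lam j = (\<Sum>i=1..n. p i ^ j)"
    and "lam 1 > 0"
    and "\<And>m. mu m = (\<integral>\<omega>. falling (\<Sum>i=1..n. X i \<omega>) m \<partial>M)"
  shows "(\<forall>m. mu m = fact m * elem_sym n p m) \<and>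
    (\<forall>m\<ge>1.
       lam 1 ^ m - falling m 2 / 2 * lam 2 * lam 1 powi (int m - 2) \<le> mu m \<and>
       mu m \<le> lam 1 ^ m - falling m 2 / 2 * lam 2 * lam 1 powi (int m - 2)
                + falling m 3 / 3 * lam 3 * lam 1 powi (int m - 3)
                + falling m 4 / 8 * (lam 2)\<^sup>2 * lam 1 powi (int m - 4) \<and>
       summable (factorial_moment_term (phi3 (lam 1) (lam 2) (lam 3)) m) \<and>
       lam 1 ^ m - falling m 2 / 2 * lam 2 * lam 1 powi (int m - 2)
         + falling m 3 / 3 * lam 3 * lam 1 powi (int m - 3)
         + falling m 4 / 8 * (lam 2)\<^sup>2 * lam 1 powi (int m - 4)
         = factorial_moment (phi3 (lam 1) (lam 2) (lam 3)) m)"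
proof (intro conjI allI impI)
  let ?G = "\<Prod>i=1..n. linear_factor (p i)"
  have p_nonneg: "0 \<le> p i" if "i \<in> {1..n}" for i
    using assms(5)[OF that] by simp
  show mu: "mu m = fact m * elem_sym n p m" for m
    unfolding assms(8) by (rule factorial_moment_eq_elem_sym[OF assms(1,3,4,5)])
  have mu_nth: "mu m = fact m * fps_nth ?G m" for m
    by (simp only: mu prod_linear_factor_nth)
  have lam: "lam 1 = (\<Sum>i=1..n. p i)" "lam 2 = (\<Sum>i=1..n. p i ^ 2)" "lam 3 = (\<Sum>i=1..n. p i ^ 3)"
    by (simp_all add: assms(6))
  fix m :: nat
  have "nonneg_coeffs (?G - lower_series (lam 1) (lam 2))"
    unfolding lam by (intro lower_series_le_prod p_nonneg finite_atLeastAtMost)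
  then have "fps_nth (lower_series (lam 1) (lam 2)) m \<le> fps_nth ?G m"
    by (simp only: nonneg_coeffs_def fps_sub_nth diff_ge_0_iff_ge)
  then show "lam 1 ^ m - falling m 2 / 2 * lam 2 * lam 1 powi (int m - 2) \<le> mu m"
    unfolding mu_nth lower_series_nth[symmetric] by (intro mult_left_mono) simp_all
  have "nonneg_coeffs (upper_series (lam 1) (lam 2) (lam 3) - ?G)"
    unfolding lam by (intro prod_le_upper_series p_nonneg finite_atLeastAtMost)
  then have "fps_nth ?G m \<le> fps_nth (upper_series (lam 1) (lam 2) (lam 3)) m"
    by (simp only: nonneg_coeffs_def fps_sub_nth diff_ge_0_iff_ge)
  then show "mu m \<le> lam 1 ^ m - falling m 2 / 2 * lam 2 * lam 1 powi (int m - 2)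
      + falling m 3 / 3 * lam 3 * lam 1 powi (int m - 3)
      + falling m 4 / 8 * (lam 2)\<^sup>2 * lam 1 powi (int m - 4)"
    unfolding mu_nth upper_series_nth[symmetric] by (intro mult_left_mono) simp_all
  note sums = phi3_factorial_moment_sums[of "lam 1" "lam 2" "lam 3" m]
  show "summable (factorial_moment_term (phi3 (lam 1) (lam 2) (lam 3)) m)"
    using sums assms(7) by (auto simp: sums_iff)
  show "lam 1 ^ m - falling m 2 / 2 * lam 2 * lam 1 powi (int m - 2)
      + falling m 3 / 3 * lam 3 * lam 1 powi (int m - 3)
      + falling m 4 / 8 * (lam 2)\<^sup>2 * lam 1 powi (int m - 4)
      = factorial_moment (phi3 (lam 1) (lam 2) (lam 3)) m"
    using sums assms(7)
    by (simp add: sums_iff factorial_moment_def power_int_diff algebra_simps)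
qed

end
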